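(* For $n\ge1$ let $\mathcal{L}_n$ be the simplicial complex with vertex set $[n]$ whose faces are the subsets of $[n]$ containing no pair $\{i,i+1\}$, $i\in[n-1]$. Then: (1) $\mathcal{L}_{n+3}\simeq\mathrm{susp}\,\mathcal{L}_n$. (2) The generating simplex for $\mathcal{L}_n$ is $(2,5,\dots,3k+2)$ if $n=3k+2$, and $(2,5,\dots,3k-1)$ if $n=3k$. (3) $\mathcal{L}_1$ is contractible, $\mathcal{L}_2=S^0$, and $\mathcal{L}_3\simeq S^0$. Hence $$\mathcal{L}_n\simeq\begin{cases}S^{k-1},&\text{if }n=3k;\\\text{a point},&\text{if }n=3k+1;\\S^k,&\text{if }n=3k+2.\end{cases}$$
   Context: $[n]=\{1,\dots,n\}$; $\mathrm{susp}$ denotes suspension. A set $\{F_1,\dots,F_t\}$ of maximal simplices of a simplicial complex $\Delta$ is called generating for $\Delta$ if $\Delta\setminus\bigcup_{i}\{F_i\}$ (the subcomplex obtained by deleting the simplices $F_1,\dots,F_t$) is contractible; in that case $\Delta\simeq\bigvee_{i=1}^tS^{\dim F_i}$. Part (2) asserts that the indicated simplex alone forms a generating set. *)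

theory Defs
  imports "HOL-Analysis.Analysis"
begin

definition L_complex :: "nat \<Rightarrow> nat set set" where
  "L_complex n = {\<sigma>. \<sigma> \<subseteq> {1..n} \<and> (\<forall>i\<in>{1..n - 1}. \<not> {i, i + 1} \<subseteq> \<sigma>)}"

text \<open>
  The points of the realization are the barycentric coordinate functions.  The topology
  is that of pointwise convergence, which is the usual topology of the realization when
  the complex \<open>K\<close> is finite; only finite complexes are used below.  The empty set may be
  a face of \<open>K\<close>; it contributes no point, since coordinates add up to 1.
\<close>

definition geometric_realization :: "'a set set \<Rightarrow> ('a \<Rightarrow> real) topology" where
  "geometric_realization K =
     subtopology (powertop_real UNIV)
       {x. \<exists>\<sigma>\<in>K. (\<forall>v\<in>\<sigma>. 0 \<le> x v) \<and> (\<forall>v. v \<notin> \<sigma> \<longrightarrow> x v = 0) \<and> (\<Sum>v\<in>\<sigma>. x v) = 1}"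

text \<open>
  The unreduced suspension of a nonempty space \<open>X\<close>: the quotient of \<open>X \<times> [0,1]\<close> in which
  \<open>X \<times> {0}\<close> and \<open>X \<times> {1}\<close> are each collapsed to a point.  The points of the quotient
  are the equivalence classes.
\<close>

definition suspension_class :: "'a topology \<Rightarrow> 'a \<times> real \<Rightarrow> ('a \<times> real) set" where
  "suspension_class X z =
     (if snd z = 0 then topspace X \<times> {0}
      else if snd z = 1 then topspace X \<times> {1}
      else {z})"

definition suspension :: "'a topology \<Rightarrow> ('a \<times> real) set topology" where
  "suspension X =
     (let C = prod_topology X (top_of_set {0..1})
      in topology (\<lambda>U. U \<subseteq> suspension_class X ` topspace C \<and>
                       openin C {z \<in> topspace C. suspension_class X z \<in> U}))"

lemma istopology_quotient:
  "istopology (\<lambda>U. U \<subseteq> q ` topspace X \<and> openin X {z \<in> topspace X. q z \<in> U})"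
  unfolding istopology_def
proof (intro conjI allI impI; (elim conjE)?)
  fix S T
  assume "openin X {z \<in> topspace X. q z \<in> S}" "openin X {z \<in> topspace X. q z \<in> T}"
  then have "openin X ({z \<in> topspace X. q z \<in> S} \<inter> {z \<in> topspace X. q z \<in> T})"
    by (rule openin_Int)
  then show "openin X {z \<in> topspace X. q z \<in> S \<inter> T}"
    by (rule back_subst[where P = "openin X"]) auto
next
  fix \<K>
  assume *: "\<forall>K\<in>\<K>. K \<subseteq> q ` topspace X \<and> openin X {z \<in> topspace X. q z \<in> K}"
  then show "\<Union>\<K> \<subseteq> q ` topspace X"
    by blast
  have "openin X (\<Union>K\<in>\<K>. {z \<in> topspace X. q z \<in> K})"
    using * by blast
  then show "openin X {z \<in> topspace X. q z \<in> \<Union>\<K>}"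
    by (rule back_subst[where P = "openin X"]) auto
qed blast

lemma quotient_map_suspension_class:
  "quotient_map (prod_topology X (top_of_set {0..1})) (suspension X) (suspension_class X)"
proof -
  let ?C = "prod_topology X (top_of_set {0..1::real})" and ?q = "suspension_class X"
  have op: "openin (suspension X) U \<longleftrightarrow>
      U \<subseteq> ?q ` topspace ?C \<and> openin ?C {z \<in> topspace ?C. ?q z \<in> U}" for U
    unfolding suspension_def Let_def
    by (simp only: topology_inverse'[OF istopology_quotient])
  have "{z \<in> topspace ?C. ?q z \<in> ?q ` topspace ?C} = topspace ?C"
    by blast
  then have "openin (suspension X) (?q ` topspace ?C)"
    unfolding op by (simp only: openin_topspace order_refl simp_thms)
  then have "?q ` topspace ?C \<subseteq> topspace (suspension X)"
    by (rule openin_subset)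
  moreover have "topspace (suspension X) \<subseteq> ?q ` topspace ?C"
    using op openin_topspace by blast
  ultimately have "topspace (suspension X) = ?q ` topspace ?C"
    by (rule subset_antisym[rotated])
  then show ?thesis
    unfolding quotient_map_def op by blast
qed

text \<open>The empty space satisfies \<^const>\<open>contractible_space\<close>, hence the second conjunct.\<close>

definition contractible_complex :: "'a set set \<Rightarrow> bool" where
  "contractible_complex K \<longleftrightarrow>
     contractible_space (geometric_realization K) \<and> topspace (geometric_realization K) \<noteq> {}"

definition maximal_simplices :: "'a set set \<Rightarrow> 'a set set" where
  "maximal_simplices K = {F \<in> K. \<forall>G\<in>K. F \<subseteq> G \<longrightarrow> G = F}"

definition generating :: "'a set set \<Rightarrow> 'a set set \<Rightarrow> bool" where
  "generating K S \<longleftrightarrow>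
     finite S \<and> S \<subseteq> maximal_simplices K \<and> contractible_complex (K - S)"

end

theory Submission
  imports Defs
begin

text \<open>
  If adding a vertex \<open>u\<close> to any face that contains \<open>v\<close> gives a face again, then shifting the weight of
  \<open>v\<close> to \<open>u\<close> is a deformation retraction onto the subcomplex without \<open>v\<close>.  In \<open>L_complex (n + 3)\<close>
  the vertex \<open>n + 1\<close> folds onto \<open>n + 3\<close>, which leaves the join of \<open>L_complex n\<close> with two points, that
  is, the suspension.  Folding \<open>3 * j\<close> onto \<open>3 * j - 2\<close> for \<open>j = 1, 2, \<dots>\<close> removes all multiples of 3.
  What remains is a cone if \<open>n = 3 * k + 1\<close>, and otherwise the boundary of a cross-polytope with
  opposite vertices \<open>3 * i + 1\<close> and \<open>3 * i + 2\<close>.  These folds never involve the facet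
  \<open>{2, 5, \<dots>}\<close>, so they still work once this facet is deleted; the result is then a sphere without an
  open orthant, which is contracted by pushing all coordinates towards the opposite orthant.
\<close>

section \<open>Points of the realization and their supporting faces\<close>

definition realization_points :: "'a set set \<Rightarrow> ('a \<Rightarrow> real) set" where
  "realization_points K =
     {x. \<exists>\<sigma>\<in>K. (\<forall>v\<in>\<sigma>. 0 \<le> x v) \<and> (\<forall>v. v \<notin> \<sigma> \<longrightarrow> x v = 0) \<and> (\<Sum>v\<in>\<sigma>. x v) = 1}"

text \<open>The product topology on all functions is the standard topology of the function type, so
  \<open>continuous_on\<close> and \<open>compact\<close> become available for realizations.\<close>

lemma geometric_realization_eq: "geometric_realization K = top_of_set (realization_points K)"
  by (simp add: geometric_realization_def realization_points_def euclidean_product_topology)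

lemma realization_pointsI:
  assumes "\<sigma> \<in> K" "\<And>v. v \<in> \<sigma> \<Longrightarrow> 0 \<le> x v" "\<And>v. v \<notin> \<sigma> \<Longrightarrow> x v = 0" "sum x \<sigma> = 1"
  shows "x \<in> realization_points K"
  using assms by (auto simp: realization_points_def)

lemma realization_pointsE:
  assumes "x \<in> realization_points K"
  obtains \<sigma> where "\<sigma> \<in> K" "finite \<sigma>" "\<And>v. 0 \<le> x v" "\<And>v. v \<notin> \<sigma> \<Longrightarrow> x v = 0" "sum x \<sigma> = 1"
proof -
  from assms obtain \<sigma> where \<sigma>: "\<sigma> \<in> K" "\<forall>v\<in>\<sigma>. 0 \<le> x v" "\<forall>v. v \<notin> \<sigma> \<longrightarrow> x v = 0" "sum x \<sigma> = 1"
    by (auto simp: realization_points_def)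
  \<comment> \<open>A sum over an infinite set is 0 by default, so a face carrying total weight 1 is
    finite.\<close>
  moreover have "finite \<sigma>"
    using \<sigma>(4) by (metis sum.infinite zero_neq_one)
  moreover have "0 \<le> x v" for v
    using \<sigma>(2,3) by (cases "v \<in> \<sigma>") auto
  ultimately show thesis
    using that by blast
qed

lemma realization_points_mono: "K \<subseteq> L \<Longrightarrow> realization_points K \<subseteq> realization_points L"
  by (auto simp: realization_points_def)

lemma realization_points_segment:
  assumes "\<sigma> \<in> K" "finite \<sigma>" "t \<in> {0..1::real}"
    and x: "\<And>v. 0 \<le> x v" "\<And>v. v \<notin> \<sigma> \<Longrightarrow> x v = 0" "sum x \<sigma> = 1"
    and y: "\<And>v. 0 \<le> y v" "\<And>v. v \<notin> \<sigma> \<Longrightarrow> y v = 0" "sum y \<sigma> = 1"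
  shows "(\<lambda>v. (1 - t) * x v + t * y v) \<in> realization_points K"
proof (rule realization_pointsI[of \<sigma>])
  have "(\<Sum>v\<in>\<sigma>. (1 - t) * x v + t * y v) = (1 - t) * sum x \<sigma> + t * sum y \<sigma>"
    by (simp add: sum.distrib sum_distrib_left)
  then show "(\<Sum>v\<in>\<sigma>. (1 - t) * x v + t * y v) = 1"
    using x y by simp
qed (use assms in auto)

section \<open>Straight-line homotopies: folds and cones\<close>

lemma homotopic_straight_line:
  fixes f g :: "'a::topological_space \<Rightarrow> 'b \<Rightarrow> real"
  assumes "continuous_on S f" "continuous_on S g"
    and "\<And>t x. t \<in> {0..1} \<Longrightarrow> x \<in> S \<Longrightarrow> (\<lambda>v. (1 - t) * f x v + t * g x v) \<in> T"
  shows "homotopic_with_canon (\<lambda>_. True) S T f g"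
  unfolding homotopic_with_def
proof (intro exI conjI allI ballI)
  let ?h = "\<lambda>(t::real, x) v. (1 - t) * f x v + t * g x v"
  have *: "continuous_on ({0..1::real} \<times> S) (\<lambda>z. k (snd z) v)"
    if "continuous_on S k" for k :: "'a \<Rightarrow> 'b \<Rightarrow> real" and v
    using continuous_on_product_then_coordinatewise[OF that]
    by (rule continuous_on_compose2) (auto intro: continuous_on_snd continuous_on_id)
  have "continuous_on ({0..1} \<times> S) (\<lambda>z. ?h z v)" for v
    unfolding case_prod_beta
    by (intro continuous_on_add continuous_on_mult continuous_on_diff continuous_on_const
        continuous_on_fst continuous_on_id *[OF assms(1)] *[OF assms(2)])
  then have "continuous_on ({0..1} \<times> S) ?h"
    by (rule continuous_on_coordinatewise_then_product)
  then show "continuous_map (prod_topology (top_of_set {0..1}) (top_of_set S)) (top_of_set T) ?h"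
    using assms(3) by auto
qed auto

text \<open>The retraction \<open>r\<close> moves the weight of \<open>v\<close> to
  \<open>u\<close>. If \<open>x\<close> is supported on a face \<sigma> containing \<open>v\<close>,
  then \<open>x\<close> and \<open>r x\<close> both live on \<open>insert u \<sigma>\<close>, so the
  segment between them stays in the realization; points that vanish at \<open>v\<close> are fixed.
  \<open>K\<close> is not assumed to be closed under subsets, hence two separate demands on
  \<sigma>.\<close>

lemma homotopy_equivalent_fold:
  assumes "u \<noteq> v"
    and "\<And>\<sigma>. \<sigma> \<in> K \<Longrightarrow> v \<in> \<sigma> \<Longrightarrow> insert u \<sigma> \<in> K \<and> insert u \<sigma> - {v} \<in> K"
  shows "geometric_realization K homotopy_equivalent_space geometric_realization {\<sigma>\<in>K. v \<notin> \<sigma>}"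
proof -
  let ?K' = "{\<sigma>\<in>K. v \<notin> \<sigma>}"
  define r :: "('a \<Rightarrow> real) \<Rightarrow> 'a \<Rightarrow> real"
    where "r x = (\<lambda>w. if w = v then 0 else if w = u then x u + x v else x w)" for x
  have coord: "continuous_on S (\<lambda>x. x w)" for S :: "('a \<Rightarrow> real) set" and w
    by (rule continuous_on_product_then_coordinatewise[OF continuous_on_id])
  have cont: "continuous_on S r" for S
  proof (rule continuous_on_coordinatewise_then_product)
    fix w
    show "continuous_on S (\<lambda>x. r x w)"
      unfolding r_def by (cases "w = v"; cases "w = u") 
        (simp_all add: continuous_on_add coord)
  qed
  have r_id: "r x = x" if "x v = 0" for x
    using that by (auto simp: r_def)
  have main: "r x \<in> realization_points ?K' \<and> (\<forall>t\<in>{0..1}. (\<lambda>w. (1 - t) * r x w + t * x w) \<in> realization_points K)"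
    if x: "x \<in> realization_points K" for x
  proof -
    from x obtain \<sigma> where \<sigma>: "\<sigma> \<in> K" "finite \<sigma>" "\<And>v. 0 \<le> x v" "\<And>v. v \<notin> \<sigma> \<Longrightarrow> x v = 0" "sum x \<sigma> = 1"
      by (rule realization_pointsE) blast
    show ?thesis
    proof (cases "v \<in> \<sigma>")
      case False
      then show ?thesis
        using \<sigma> x by (auto simp: r_id left_diff_distrib intro: realization_pointsI[of \<sigma>])
    next
      case True
      let ?\<tau> = "insert u \<sigma>"
      \<comment> \<open>If \<open>u\<close> is not in \<sigma>, then \<open>x u = 0\<close>, so
        enlarging the face does not change the sum.\<close>
      have sx: "sum x ?\<tau> = 1"
        using \<sigma> by (metis sum.insert insert_absorb add_0)
      have "?\<tau> = insert u (insert v (?\<tau> - {u, v}))"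
        using True by auto
      then have split: "sum f ?\<tau> = f u + (f v + sum f (?\<tau> - {u, v}))" for f :: "'a \<Rightarrow> real"
        using assms(1) \<sigma>(2)
        by (metis (no_types, lifting) Diff_iff finite_insert finite_Diff insert_iff sum.insert)
      have "sum (r x) (?\<tau> - {u, v}) = sum x (?\<tau> - {u, v})"
        by (rule sum.cong) (auto simp: r_def)
      then have sr: "sum (r x) ?\<tau> = 1"
        using sx split[of x] split[of "r x"] assms(1) by (simp add: r_def)
      have "sum (r x) (?\<tau> - {v}) = 1"
        using sr \<sigma>(2) by (subst sum_diff1) (auto simp: r_def)
      then have "r x \<in> realization_points ?K'"
        using assms \<sigma> True by (intro realization_pointsI[of "?\<tau> - {v}"]) (auto simp: r_def)
      moreover have "(\<lambda>w. (1 - t) * r x w + t * x w) \<in> realization_points K" if "t \<in> {0..1}" for t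
        using assms \<sigma> True sx sr that
        by (intro realization_points_segment[of ?\<tau>]) (auto simp: r_def)
      ultimately show ?thesis
        by blast
    qed
  qed
  have sub: "realization_points ?K' \<subseteq> realization_points K"
    by (rule realization_points_mono) auto
  have "x v = 0" if "x \<in> realization_points ?K'" for x
    using that by (auto simp: realization_points_def)
  then have "homotopic_with_canon (\<lambda>_. True) (realization_points ?K') (realization_points ?K') (r \<circ> id) id"
    using main sub cont r_id by (intro homotopic_with_equal) auto
  moreover have "homotopic_with_canon (\<lambda>_. True) (realization_points K) (realization_points K) (id \<circ> r) id"
    using main cont by (intro homotopic_straight_line) (auto simp: id_def)
  ultimately show ?thesis
    unfolding homotopy_equivalent_space_def geometric_realization_eq
    using main sub cont by (intro exI[of _ r] exI[of _ id]) (auto simp: continuous_on_id)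
qed

text \<open>Every point is joined to the apex \<open>w\<close> by a segment inside
  \<open>insert w \<sigma>\<close>. The face \<open>{}\<close> yields the face \<open>{w}\<close>,
  which makes the apex a point of the realization.\<close>

lemma contractible_complex_cone:
  assumes "{} \<in> K" "\<And>\<sigma>. \<sigma> \<in> K \<Longrightarrow> insert w \<sigma> \<in> K"
  shows "contractible_complex K"
proof -
  let ?c = "\<lambda>v. if v = w then 1 else 0::real"
  have c: "?c \<in> realization_points K"
    using assms by (intro realization_pointsI[of "{w}"]) auto
  have "(\<lambda>v. (1 - t) * id x v + t * ?c v) \<in> realization_points K"
    if "t \<in> {0..1}" and x: "x \<in> realization_points K" for t x
  proof -
    from x obtain \<sigma> where \<sigma>: "\<sigma> \<in> K" "finite \<sigma>" "\<And>v. 0 \<le> x v" "\<And>v. v \<notin> \<sigma> \<Longrightarrow> x v = 0" "sum x \<sigma> = 1"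
      by (rule realization_pointsE) blast
    have "sum x (insert w \<sigma>) = 1"
      using \<sigma> by (metis sum.insert insert_absorb add_0)
    moreover have "sum ?c (insert w \<sigma>) = 1"
      using \<sigma> by (subst sum.delta) auto
    ultimately show ?thesis
      using \<sigma> assms that by (intro realization_points_segment[of "insert w \<sigma>"]) auto
  qed
  then have "homotopic_with_canon (\<lambda>_. True) (realization_points K) (realization_points K) id (\<lambda>_. ?c)"
    by (intro homotopic_straight_line) (auto simp: continuous_on_id id_def)
  then show ?thesis
    using c by (auto simp: contractible_complex_def geometric_realization_eq contractible_space_def)
qed

section \<open>Independence complexes of sets of naturals, and folding away the multiples of
  3\<close>

definition indep :: "nat set \<Rightarrow> nat set set" where
  "indep V = {\<sigma>. \<sigma> \<subseteq> V \<and> (\<forall>i. \<not> (i \<in> \<sigma> \<and> Suc i \<in> \<sigma>))}"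

lemma L_complex_eq_indep: "L_complex n = indep {1..n}"
  unfolding L_complex_def indep_def by (fastforce simp: subset_eq)

text \<open>Since \<open>indep V\<close> is closed under subsets, the support of a point can serve
  as its face. Membership thus becomes a condition on the coordinates alone.\<close>

lemma realization_points_indep:
  assumes "finite V"
  shows "x \<in> realization_points (indep V) \<longleftrightarrow>
    (\<forall>v. 0 \<le> x v) \<and> (\<forall>v. v \<notin> V \<longrightarrow> x v = 0) \<and> sum x V = 1 \<and> (\<forall>i. x i = 0 \<or> x (Suc i) = 0)"
    (is "_ \<longleftrightarrow> ?R")
proof
  assume "x \<in> realization_points (indep V)"
  then obtain \<sigma> where \<sigma>: "\<sigma> \<in> indep V" "finite \<sigma>" "\<And>v. 0 \<le> x v" "\<And>v. v \<notin> \<sigma> \<Longrightarrow> x v = 0" "sum x \<sigma> = 1"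
    by (rule realization_pointsE) blast
  moreover have "sum x \<sigma> = sum x V"
    using \<sigma> assms by (intro sum.mono_neutral_left) (auto simp: indep_def)
  moreover have "x i = 0 \<or> x (Suc i) = 0" for i
    using \<sigma>(1) \<sigma>(4)[of i] \<sigma>(4)[of "Suc i"] by (auto simp: indep_def)
  ultimately show ?R
    by (auto simp: indep_def)
next
  assume R: ?R
  then have "sum x {v. x v \<noteq> 0} = sum x V"
    using assms by (intro sum.mono_neutral_left) auto
  with R show "x \<in> realization_points (indep V)"
    by (intro realization_pointsI[of "{v. x v \<noteq> 0}"]) (auto simp: indep_def)
qed

text \<open>The induction step folds \<open>3 * j + 3\<close> onto \<open>3 * j + 1\<close>. A face
  with \<open>3 * j + 3\<close> does not contain \<open>3 * j + 2\<close>, and \<open>3 * j\<close>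
  is already gone, so adding \<open>3 * j + 1\<close> creates no consecutive pair. A set with the
  element \<open>3 * j + 1\<close> is never in \<open>S\<close>, so both sets required by the fold
  survive the deletion of \<open>S\<close>.\<close>

lemma homotopy_equivalent_fold_multiples:
  assumes S: "\<And>F i. F \<in> S \<Longrightarrow> i \<in> F \<Longrightarrow> i mod 3 = 2"
  shows "geometric_realization (indep {1..n} - S) homotopy_equivalent_space
    geometric_realization (indep {i\<in>{1..n}. \<not> (3 dvd i \<and> i \<le> 3 * j)} - S)"
proof (induction j)
  case 0
  have "{i\<in>{1..n}. \<not> (3 dvd i \<and> i \<le> 3 * 0)} = {1..n}"
    by auto
  then show ?case
    by (simp add: homotopy_equivalent_space_refl)
next
  case (Suc j)
  let ?V = "\<lambda>j. {i\<in>{1..n}. \<not> (3 dvd i \<and> i \<le> 3 * j)}"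
  have V: "?V (Suc j) = ?V j - {3 * j + 3}"
  proof (rule set_eqI)
    fix i
    show "i \<in> ?V (Suc j) \<longleftrightarrow> i \<in> ?V j - {3 * j + 3}"
      by simp presburger
  qed
  show ?case
  proof (cases "3 * j + 3 \<le> n")
    case False
    then have "?V (Suc j) = ?V j"
      unfolding V by auto
    then show ?thesis
      using Suc by simp
  next
    case True
    have fold: "insert (3 * j + 1) \<sigma> \<in> indep (?V j) - S \<and> insert (3 * j + 1) \<sigma> - {3 * j + 3} \<in> indep (?V j) - S"
      if \<sigma>: "\<sigma> \<in> indep (?V j) - S" and v: "3 * j + 3 \<in> \<sigma>" for \<sigma>
    proof -
      have \<sigma>': "\<sigma> \<subseteq> ?V j" "\<And>i. i \<in> \<sigma> \<Longrightarrow> Suc i \<notin> \<sigma>"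
        using \<sigma> by (auto simp: indep_def)
      have "3 * j + 2 \<notin> \<sigma>"
        using \<sigma>'(2)[of "3 * j + 2"] v by (auto simp: numeral_3_eq_3)
      moreover have "3 * j \<notin> \<sigma>"
        using \<sigma>'(1) by auto
      moreover have "3 * j + 1 \<in> ?V j"
        using True by simp
      ultimately have "insert (3 * j + 1) \<sigma> \<in> indep (?V j)"
        using \<sigma>' unfolding indep_def by auto
      moreover have "3 * j + 1 \<notin> F" if "F \<in> S" for F
      proof
        assume "3 * j + 1 \<in> F"
        with S[OF that this] show False
          by presburger
      qed
      then have "insert (3 * j + 1) \<sigma> \<notin> S" "insert (3 * j + 1) \<sigma> - {3 * j + 3} \<notin> S"
        by force+
      ultimately show ?thesis
        by (auto simp: indep_def)
    qed
    have "geometric_realization (indep (?V j) - S) homotopy_equivalent_space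
        geometric_realization {\<sigma> \<in> indep (?V j) - S. 3 * j + 3 \<notin> \<sigma>}"
      by (rule homotopy_equivalent_fold[of "3 * j + 1"]) (simp, rule fold)
    moreover have "{\<sigma> \<in> indep (?V j) - S. 3 * j + 3 \<notin> \<sigma>} = indep (?V (Suc j)) - S"
      unfolding V by (auto simp: indep_def)
    ultimately show ?thesis
      using homotopy_eqv_trans[OF Suc] by simp
  qed
qed

lemma homotopy_equivalent_non_multiples:
  assumes "\<And>F i. F \<in> S \<Longrightarrow> i \<in> F \<Longrightarrow> i mod 3 = 2"
  shows "geometric_realization (indep {1..n} - S) homotopy_equivalent_space
    geometric_realization (indep {i\<in>{1..n}. \<not> 3 dvd i} - S)"
proof -
  \<comment> \<open>With \<open>j = n\<close> the bound \<open>3 * n\<close> is no restriction on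
    \<open>{1..n}\<close>, so all multiples of 3 are removed.\<close>
  have "{i\<in>{1..n}. \<not> (3 dvd i \<and> i \<le> 3 * n)} = {i\<in>{1..n}. \<not> 3 dvd i}"
    by auto
  then show ?thesis
    using homotopy_equivalent_fold_multiples[of S n n] assms by metis
qed

section \<open>The boundary of the cross-polytope and its distinguished facet\<close>

definition pair_vertices :: "nat \<Rightarrow> nat set" where
  "pair_vertices m = {v. v mod 3 \<noteq> 0 \<and> v div 3 < m}"

lemma pair_vertices_Suc:
  "pair_vertices (Suc m) = insert (3 * m + 1) (insert (3 * m + 2) (pair_vertices m))"
proof (rule set_eqI)
  fix v
  have "v mod 3 \<noteq> 0 \<and> v div 3 = m \<longleftrightarrow> v = 3 * m + 1 \<or> v = 3 * m + 2"
    by presburger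
  moreover have "(3 * m + 1) div 3 = m" "(3 * m + 2) div 3 = m"
    by simp_all
  ultimately show "v \<in> pair_vertices (Suc m) \<longleftrightarrow>
      v \<in> insert (3 * m + 1) (insert (3 * m + 2) (pair_vertices m))"
    unfolding pair_vertices_def less_Suc_eq by blast
qed

lemma finite_pair_vertices: "finite (pair_vertices m)"
  by (induction m) (simp_all add: pair_vertices_Suc, simp add: pair_vertices_def)

lemma sum_pair_vertices:
  "sum x (pair_vertices m) = (\<Sum>i<m. x (3 * i + 1) + x (3 * i + 2))"
  for x :: "nat \<Rightarrow> real"
proof (induction m)
  case (Suc m)
  have "3 * m + 1 \<notin> insert (3 * m + 2) (pair_vertices m)" "3 * m + 2 \<notin> pair_vertices m"
    by (auto simp: pair_vertices_def)
  then show ?case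
    using Suc by (simp add: pair_vertices_Suc finite_pair_vertices)
qed (simp add: pair_vertices_def)

text \<open>The only consecutive numbers in \<open>pair_vertices m\<close> are
  \<open>3 * i + 1\<close> and \<open>3 * i + 2\<close>, so a face picks at most one element of each
  pair, independently of the other pairs: the complex is the join of \<open>m\<close> copies of two
  points.\<close>

lemma realization_points_pairs:
  "x \<in> realization_points (indep (pair_vertices m)) \<longleftrightarrow>
    (\<forall>v. 0 \<le> x v) \<and> (\<forall>v. v \<notin> pair_vertices m \<longrightarrow> x v = 0) \<and>
    (\<Sum>i<m. x (3 * i + 1) + x (3 * i + 2)) = 1 \<and>
    (\<forall>i<m. x (3 * i + 1) = 0 \<or> x (3 * i + 2) = 0)"
    (is "?L \<longleftrightarrow> ?R")
proof
  assume ?L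
  moreover from this have "x (3 * i + 1) = 0 \<or> x (Suc (3 * i + 1)) = 0" for i
    unfolding realization_points_indep[OF finite_pair_vertices] by blast
  ultimately show ?R
    unfolding realization_points_indep[OF finite_pair_vertices] sum_pair_vertices by simp
next
  assume R: ?R
  have "x i = 0 \<or> x (Suc i) = 0" for i
  proof (cases "i \<in> pair_vertices m \<and> Suc i \<in> pair_vertices m")
    case True
    then have "i = 3 * (i div 3) + 1" "i div 3 < m"
      unfolding pair_vertices_def by (simp_all, presburger)
    then show ?thesis
      using R by (metis add_Suc_right one_add_one plus_1_eq_Suc)
  qed (use R in blast)
  then show ?L
    using R unfolding realization_points_indep[OF finite_pair_vertices] sum_pair_vertices by blast
qed

text \<open>Deleting \<open>F\<close> removes only the open simplex of \<open>F\<close>. A face that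
  contains \<open>F\<close> equals \<open>F\<close>, because \<open>F\<close> already uses every
  pair; so a point is lost exactly if all its coordinates \<open>3 * j + 2\<close> are
  nonzero.\<close>

lemma realization_points_pairs_minus_facet:
  assumes F: "F = {3 * j + 2 |j. j < m}"
  shows "realization_points (indep (pair_vertices m) - {F}) =
    realization_points (indep (pair_vertices m)) \<inter> {x. \<exists>j<m. x (3 * j + 2) = 0}"
    (is "?L = ?R")
proof
  show "?L \<subseteq> ?R"
  proof
    fix x
    assume x: "x \<in> ?L"
    then obtain \<sigma> where \<sigma>: "\<sigma> \<in> indep (pair_vertices m)" "\<sigma> \<noteq> F" "\<And>v. v \<notin> \<sigma> \<Longrightarrow> x v = 0"
      by (elim realization_pointsE) blast
    have "\<exists>j<m. x (3 * j + 2) = 0"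
    proof (rule ccontr)
      assume "\<not> ?thesis"
      then have F\<sigma>: "3 * j + 2 \<in> \<sigma>" if "j < m" for j
        using \<sigma>(3) that by blast
      have "v \<in> F" if "v \<in> \<sigma>" for v
      proof -
        have v: "v mod 3 \<noteq> 0" "v div 3 < m"
          using \<sigma>(1) that by (auto simp: indep_def pair_vertices_def)
        have "Suc v \<notin> \<sigma>"
          using \<sigma>(1) that by (auto simp: indep_def)
        \<comment> \<open>If \<open>v\<close> were the first element of its pair, then
          \<open>Suc v\<close> would be the second one, which lies in \<sigma>.\<close>
        with F\<sigma>[OF v(2)] have "Suc v \<noteq> 3 * (v div 3) + 2"
          by metis
        with v(1) have "v = 3 * (v div 3) + 2"
          by presburger
        with v(2) show ?thesis
          unfolding F by blast
      qed
      with F\<sigma> \<sigma>(2) show False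
        unfolding F by blast
    qed
    moreover have "x \<in> realization_points (indep (pair_vertices m))"
      using x realization_points_mono[of "indep (pair_vertices m) - {F}"] by blast
    ultimately show "x \<in> ?R"
      by blast
  qed
  show "?R \<subseteq> ?L"
  proof
    fix x
    assume x: "x \<in> ?R"
    then obtain j where j: "j < m" "x (3 * j + 2) = 0"
      by blast
    have x': "(\<forall>v. 0 \<le> x v) \<and> (\<forall>v. v \<notin> pair_vertices m \<longrightarrow> x v = 0) \<and>
        sum x (pair_vertices m) = 1 \<and> (\<forall>i. x i = 0 \<or> x (Suc i) = 0)"
      using x realization_points_indep[OF finite_pair_vertices] by blast
    have "sum x {v. x v \<noteq> 0} = sum x (pair_vertices m)"
      using x' by (intro sum.mono_neutral_left finite_pair_vertices) auto
    moreover have "{v. x v \<noteq> 0} \<noteq> F"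
      using j unfolding F by blast
    ultimately show "x \<in> ?L"
      using x' by (intro realization_pointsI[of "{v. x v \<noteq> 0}"]) (auto simp: indep_def)
  qed
qed

section \<open>Radial projection of the cross-polytope onto the round sphere\<close>

definition unit_sphere :: "nat \<Rightarrow> (nat \<Rightarrow> real) set" where
  "unit_sphere m = {y. L2_set y {..<m} = 1 \<and> (\<forall>i\<ge>m. y i = 0)}"

text \<open>The index of \<open>nsphere\<close> is the dimension, that of \<open>unit_sphere\<close>
  the number of coordinates, which is one more.\<close>

lemma nsphere_eq: "nsphere m = top_of_set (unit_sphere (Suc m))"
  by (simp add: nsphere unit_sphere_def L2_set_def euclidean_product_topology
      lessThan_Suc_atMost Suc_le_eq)

text \<open>Each pair becomes a coordinate axis, with \<open>3 * i + 1\<close> in the positive and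
  \<open>3 * i + 2\<close> in the negative direction. The realization turns into the unit sphere of
  the l1-norm.\<close>

definition pair_difference :: "nat \<Rightarrow> (nat \<Rightarrow> real) \<Rightarrow> nat \<Rightarrow> real" where
  "pair_difference m x i = (if i < m then x (3 * i + 1) - x (3 * i + 2) else 0)"

text \<open>Recovers the two weights of a pair from their difference, which is possible because at
  most one of them is nonzero.\<close>

definition pair_parts :: "nat \<Rightarrow> (nat \<Rightarrow> real) \<Rightarrow> nat \<Rightarrow> real" where
  "pair_parts m y v = (if v \<in> pair_vertices m then
     (if v mod 3 = 1 then max 0 (y (v div 3)) else max 0 (- y (v div 3))) else 0)"

lemma pair_parts_simps:
  assumes "i < m"
  shows "pair_parts m y (3 * i + 1) = max 0 (y i)" "pair_parts m y (3 * i + 2) = max 0 (- y i)"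
proof -
  have "(3 * i + 1) div 3 = i" "(3 * i + 1) mod 3 = 1" "(3 * i + 2) div 3 = i" "(3 * i + 2) mod 3 = 2"
    by presburger+
  then show "pair_parts m y (3 * i + 1) = max 0 (y i)" "pair_parts m y (3 * i + 2) = max 0 (- y i)"
    using assms by (simp_all only: pair_parts_def pair_vertices_def mem_Collect_eq) simp_all
qed

text \<open>The divisor \<open>c\<close> stands for the norm by which the maps between the two
  spheres rescale.\<close>

lemma pair_difference_parts:
  assumes "\<And>i. i \<ge> m \<Longrightarrow> y i = 0"
  shows "pair_difference m (\<lambda>v. pair_parts m y v / c) = (\<lambda>i. y i / c)"
proof
  fix i
  show "pair_difference m (\<lambda>v. pair_parts m y v / c) i = y i / c"
  proof (cases "i < m")
    case True
    then show ?thesis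
      unfolding pair_difference_def pair_parts_simps[OF True]
      by (simp add: max_def flip: diff_divide_distrib)
  qed (use assms in \<open>simp add: pair_difference_def\<close>)
qed

lemma pair_parts_difference:
  assumes x: "x \<in> realization_points (indep (pair_vertices m))" and "0 < c"
  shows "pair_parts m (\<lambda>i. pair_difference m x i / c) = (\<lambda>v. x v / c)"
proof
  fix v
  show "pair_parts m (\<lambda>i. pair_difference m x i / c) v = x v / c"
  proof (cases "v \<in> pair_vertices m")
    case True
    define i where "i = v div 3"
    have i: "i < m" "v = 3 * i + 1 \<or> v = 3 * i + 2"
      using True unfolding pair_vertices_def i_def by (simp_all, presburger)
    have "0 \<le> x (3 * i + 1)" "0 \<le> x (3 * i + 2)" "x (3 * i + 1) = 0 \<or> x (3 * i + 2) = 0"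
      using x i(1) unfolding realization_points_pairs by blast+
    then show ?thesis
      using i(2) \<open>0 < c\<close> pair_parts_simps[OF i(1)] i(1)
      by (auto simp: pair_difference_def max_def field_simps)
  qed (use x in \<open>simp add: pair_parts_def realization_points_pairs\<close>)
qed

text \<open>One of the two weights in a pair is 0, so the absolute value of their difference is
  their sum.\<close>

lemma sum_abs_pair_difference:
  assumes "x \<in> realization_points (indep (pair_vertices m))"
  shows "(\<Sum>i<m. \<bar>pair_difference m x i\<bar>) = 1"
proof -
  have "\<bar>pair_difference m x i\<bar> = x (3 * i + 1) + x (3 * i + 2)" if "i < m" for i
  proof -
    have "0 \<le> x (3 * i + 1)" "0 \<le> x (3 * i + 2)" "x (3 * i + 1) = 0 \<or> x (3 * i + 2) = 0"
      using assms that unfolding realization_points_pairs by blast+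
    with that show ?thesis
      by (auto simp: pair_difference_def)
  qed
  then show ?thesis
    using assms by (simp add: realization_points_pairs)
qed

lemma L2_set_pos_iff_sum_abs: "0 < L2_set y {..<m} \<longleftrightarrow> 0 < (\<Sum>i<m. \<bar>y i\<bar>)"
  for y :: "nat \<Rightarrow> real"
proof -
  have "L2_set y {..<m} = 0 \<longleftrightarrow> (\<Sum>i<m. \<bar>y i\<bar>) = 0"
    by (simp add: L2_set_eq_0_iff sum_nonneg_eq_0_iff)
  moreover have "0 \<le> L2_set y {..<m}" "0 \<le> (\<Sum>i<m. \<bar>y i\<bar>)"
    by (simp_all add: L2_set_nonneg sum_nonneg)
  ultimately show ?thesis
    by linarith
qed

lemma L2_set_divide: "0 < c \<Longrightarrow> L2_set (\<lambda>i. y i / c) A = L2_set y A / c" for c :: real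
  using L2_set_left_distrib[of "inverse c" y A] by (simp add: divide_inverse)

text \<open>\<open>f\<close> rescales a point of the l1-sphere to Euclidean norm 1, and
  \<open>g\<close> rescales back to l1-norm 1 before the coordinates are split into pairs. Neither
  norm vanishes on the sphere of the other, so both maps are continuous.\<close>

lemma homeomorphic_maps_cross_polytope:
  defines "f \<equiv> \<lambda>m x i. pair_difference m x i / L2_set (pair_difference m x) {..<m}"
    and "g \<equiv> \<lambda>m y v. pair_parts m y v / (\<Sum>i<m. \<bar>y i\<bar>)"
  shows "homeomorphic_maps (top_of_set (realization_points (indep (pair_vertices m))))
    (top_of_set (unit_sphere m)) (f m) (g m)"
proof -
  let ?X = "realization_points (indep (pair_vertices m))"
  have coord: "continuous_on S (\<lambda>x. x v)" for S :: "(nat \<Rightarrow> real) set" and v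
    by (rule continuous_on_product_then_coordinatewise[OF continuous_on_id])
  have posX: "0 < L2_set (pair_difference m x) {..<m}" if "x \<in> ?X" for x
    using sum_abs_pair_difference[OF that] by (simp add: L2_set_pos_iff_sum_abs)
  have posY: "0 < (\<Sum>i<m. \<bar>y i\<bar>)" if "y \<in> unit_sphere m" for y
    using that by (simp add: unit_sphere_def flip: L2_set_pos_iff_sum_abs)
  have d: "continuous_on S (\<lambda>x. pair_difference m x i)" for S i
    unfolding pair_difference_def
    by (cases "i < m") (simp_all add: continuous_on_diff coord)
  have L2: "continuous_on S (\<lambda>x. L2_set (pair_difference m x) {..<m})" for S
    unfolding L2_set_def
    by (intro continuous_on_real_sqrt continuous_on_sum continuous_on_power d)
  have "continuous_on ?X (f m)"
    unfolding f_def
    by (intro continuous_on_coordinatewise_then_product continuous_on_divide d L2)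
      (use posX in fastforce)
  moreover have "f m x \<in> unit_sphere m" if "x \<in> ?X" for x
  proof -
    have "L2_set (f m x) {..<m} = 1"
      unfolding f_def using posX[OF that] by (subst L2_set_divide) simp_all
    moreover have "f m x i = 0" if "i \<ge> m" for i
      using that by (simp add: f_def pair_difference_def)
    ultimately show ?thesis
      by (simp add: unit_sphere_def)
  qed
  moreover have "continuous_on S (\<lambda>y. pair_parts m y v)" for S v
    unfolding pair_parts_def
    by (cases "v \<in> pair_vertices m"; cases "v mod 3 = 1")
      (simp_all add: continuous_on_max continuous_on_minus coord)
  then have "continuous_on (unit_sphere m) (g m)"
    unfolding g_def
    by (intro continuous_on_coordinatewise_then_product continuous_on_divide
        continuous_on_sum continuous_on_rabs coord) (use posY in fastforce)+
  moreover have "g m y \<in> ?X" if "y \<in> unit_sphere m" for y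
  proof -
    have "(\<Sum>i<m. g m y (3 * i + 1) + g m y (3 * i + 2)) = (\<Sum>i<m. \<bar>y i\<bar> / (\<Sum>i<m. \<bar>y i\<bar>))"
    proof (rule sum.cong)
      fix i
      assume "i \<in> {..<m}"
      then have i: "i < m"
        by simp
      show "g m y (3 * i + 1) + g m y (3 * i + 2) = \<bar>y i\<bar> / (\<Sum>i<m. \<bar>y i\<bar>)"
        unfolding g_def pair_parts_simps[OF i] add_divide_distrib[symmetric]
        by (simp add: max_def)
    qed simp
    also have "\<dots> = 1"
      using posY[OF that] by (simp flip: sum_divide_distrib)
    finally have "(\<Sum>i<m. g m y (3 * i + 1) + g m y (3 * i + 2)) = 1" .
    moreover have "0 \<le> g m y v" "v \<notin> pair_vertices m \<Longrightarrow> g m y v = 0" for v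
      using posY[OF that] by (simp_all add: g_def pair_parts_def)
    moreover have "g m y (3 * i + 1) = 0 \<or> g m y (3 * i + 2) = 0" if "i < m" for i
      unfolding g_def pair_parts_simps[OF that] by (simp add: max_def)
    ultimately show ?thesis
      unfolding realization_points_pairs by blast
  qed
  moreover have "g m (f m x) = x" if "x \<in> ?X" for x
  proof -
    \<comment> \<open>The l1-norm of \<open>f m x\<close> is the reciprocal of the divisor used by
      \<open>f\<close>, so the division in \<open>g\<close> cancels that divisor.\<close>
    have "(\<Sum>i<m. \<bar>f m x i\<bar>) = 1 / L2_set (pair_difference m x) {..<m}"
      using posX[OF that] sum_abs_pair_difference[OF that]
      by (simp add: f_def flip: sum_divide_distrib)
    moreover have "pair_parts m (f m x) = (\<lambda>v. x v / L2_set (pair_difference m x) {..<m})"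
      unfolding f_def by (rule pair_parts_difference[OF that posX[OF that]])
    ultimately show ?thesis
      using posX[OF that] by (simp add: g_def)
  qed
  moreover have "f m (g m y) = y" if y: "y \<in> unit_sphere m" for y
  proof -
    have "pair_difference m (g m y) = (\<lambda>i. y i / (\<Sum>i<m. \<bar>y i\<bar>))"
      unfolding g_def using y by (intro pair_difference_parts) (auto simp: unit_sphere_def)
    then show ?thesis
      using posY[OF y] y by (simp add: f_def L2_set_divide unit_sphere_def)
  qed
  ultimately show ?thesis
    unfolding homeomorphic_maps_def by auto
qed

lemma unit_sphere_homeomorphic_pairs:
  "geometric_realization (indep (pair_vertices m)) homeomorphic_space top_of_set (unit_sphere m)"
  unfolding geometric_realization_eq homeomorphic_space_def
  using homeomorphic_maps_cross_polytope by blast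

section \<open>Contractibility after deletion of the facet\<close>

lemma contractible_space_sphere_part:
  assumes "0 < m"
  shows "contractible_space (top_of_set {y \<in> unit_sphere m. \<exists>i<m. 0 \<le> y i})"
proof -
  let ?T = "{y \<in> unit_sphere m. \<exists>i<m. 0 \<le> y i}"
  \<comment> \<open>The segment from \<open>y\<close> to the vector whose \<open>m\<close>
    coordinates are all 1; \<open>h\<close> projects it back to the sphere.\<close>
  define w :: "real \<times> (nat \<Rightarrow> real) \<Rightarrow> nat \<Rightarrow> real"
    where "w = (\<lambda>(t, y) i. if i < m then (1 - t) * y i + t else 0)"
  define h where "h = (\<lambda>z i. w z i / L2_set (w z) {..<m})"
  have pos: "0 < L2_set (w (t, y)) {..<m} \<and> (\<exists>i<m. 0 \<le> w (t, y) i)"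
    if t: "t \<in> {0..1}" and y: "y \<in> ?T" for t y
  proof
    obtain i where i: "i < m" "0 \<le> y i"
      using y by blast
    have "0 \<le> w (t, y) i"
      using i t by (simp add: w_def)
    with i show "\<exists>i<m. 0 \<le> w (t, y) i"
      by blast
    \<comment> \<open>The segment misses the origin: at \<open>t = 0\<close> the norm is that of
      \<open>y\<close>, and for \<open>t > 0\<close> the nonnegative coordinate \<open>i\<close> of
      \<open>y\<close> has become positive.\<close>
    have "L2_set (w (t, y)) {..<m} \<noteq> 0"
    proof (cases "t = 0")
      case True
      have "L2_set (w (t, y)) {..<m} = L2_set y {..<m}"
        by (rule L2_set_cong) (simp_all add: w_def True)
      then show ?thesis
        using y by (simp add: unit_sphere_def)
    next
      case False
      then have "0 < w (t, y) i"
        using i t by (simp add: w_def add_nonneg_pos)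
      with i(1) have "\<not> (\<forall>i\<in>{..<m}. w (t, y) i = 0)"
        by (metis lessThan_iff less_irrefl)
      then show ?thesis
        by (simp add: L2_set_eq_0_iff)
    qed
    then show "0 < L2_set (w (t, y)) {..<m}"
      using L2_set_nonneg[of "w (t, y)" "{..<m}"] by linarith
  qed
  have w_cont: "continuous_on ({0..1} \<times> ?T) (\<lambda>z. w z i)" for i
  proof -
    have snd: "continuous_on ({0..1} \<times> ?T) (\<lambda>z. snd z i)"
      by (rule continuous_on_product_then_coordinatewise[OF continuous_on_snd[OF continuous_on_id]])
    have "continuous_on ({0..1} \<times> ?T) (\<lambda>z. (1 - fst z) * snd z i + fst z)"
      by (intro continuous_on_add continuous_on_mult continuous_on_diff
          continuous_on_const continuous_on_fst continuous_on_id snd)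
    then show ?thesis
      unfolding w_def case_prod_beta by (cases "i < m") simp_all
  qed
  have "continuous_on ({0..1} \<times> ?T) (\<lambda>z. L2_set (w z) {..<m})"
    unfolding L2_set_def
    by (intro continuous_on_real_sqrt continuous_on_sum continuous_on_power w_cont)
  moreover have "L2_set (w z) {..<m} \<noteq> 0" if "z \<in> {0..1} \<times> ?T" for z
    using that pos by (metis (no_types, lifting) less_irrefl mem_Sigma_iff surj_pair)
  ultimately have cont: "continuous_on ({0..1} \<times> ?T) h"
    unfolding h_def
    by (intro continuous_on_coordinatewise_then_product continuous_on_divide w_cont) blast+
  have mem: "h (t, y) \<in> ?T" if "t \<in> {0..1}" "y \<in> ?T" for t y
  proof -
    have "L2_set (h (t, y)) {..<m} = 1"
      unfolding h_def using pos[OF that] by (subst L2_set_divide) simp_all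
    moreover have "h (t, y) i = 0" if "i \<ge> m" for i
      using that by (simp add: h_def w_def)
    moreover have "\<exists>i<m. 0 \<le> h (t, y) i"
      using pos[OF that] by (auto simp: h_def)
    ultimately show ?thesis
      by (simp add: unit_sphere_def)
  qed
  have h0: "h (0, y) = y" if "y \<in> ?T" for y
  proof -
    have w0: "w (0, y) = y"
      using that by (auto simp: w_def unit_sphere_def)
    then show ?thesis
      using that by (simp add: h_def w0 unit_sphere_def)
  qed
  \<comment> \<open>At \<open>t = 1\<close> the starting point has no influence. The zero function,
    which is not on the sphere, merely names the common endpoint.\<close>
  have h1: "h (1, y) = h (1, \<lambda>_. 0)" for y
  proof -
    have "w (1, y) = w (1, \<lambda>_. 0)"
      by (rule ext) (simp add: w_def)
    then show ?thesis
      by (simp add: h_def)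
  qed
  have "homotopic_with_canon (\<lambda>_. True) ?T ?T id (\<lambda>_. h (1, \<lambda>_. 0))"
  proof (subst homotopic_with, simp, intro exI[of _ h] conjI ballI)
    show "continuous_map (prod_topology (top_of_set {0..1}) (top_of_set ?T)) (top_of_set ?T) h"
      unfolding prod_topology_subtopology_eu continuous_map_subtopology_eu
      using cont mem by (metis (no_types, lifting) Pi_I SigmaE)
  qed (use h0 h1 in auto)
  then show ?thesis
    unfolding contractible_space_def by blast
qed

text \<open>The homeomorphism with the sphere restricts to the remaining complex:
  \<open>3 * j + 2\<close> has weight 0 exactly if the coordinate \<open>j\<close> on the sphere is
  nonnegative.\<close>

lemma contractible_complex_pairs_minus_facet:
  assumes "0 < m"
  shows "contractible_complex (indep (pair_vertices m) - {{3 * j + 2 |j. j < m}})"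
proof -
  let ?X = "realization_points (indep (pair_vertices m))"
  let ?S = "{x :: nat \<Rightarrow> real. \<exists>j<m. x (3 * j + 2) = 0}" and ?T = "{y :: nat \<Rightarrow> real. \<exists>i<m. 0 \<le> y i}"
  let ?f = "\<lambda>x i. pair_difference m x i / L2_set (pair_difference m x) {..<m}"
  let ?g = "\<lambda>y v. pair_parts m y v / (\<Sum>i<m. \<bar>y i\<bar>)"
  have eq: "realization_points (indep (pair_vertices m) - {{3 * j + 2 |j. j < m}}) = ?X \<inter> ?S"
    by (rule realization_points_pairs_minus_facet) simp
  have f: "?f x \<in> ?T" if x: "x \<in> ?X \<inter> ?S" for x
  proof -
    obtain j where j: "j < m" "x (3 * j + 2) = 0"
      using x by blast
    moreover have "x \<in> ?X"
      using x by blast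
    then have "0 \<le> x (3 * j + 1)"
      unfolding realization_points_pairs by blast
    ultimately have "0 \<le> pair_difference m x j"
      unfolding pair_difference_def by simp
    then have "0 \<le> ?f x j"
      by (rule divide_nonneg_nonneg[OF _ L2_set_nonneg])
    with j(1) show ?thesis
      by (intro CollectI exI conjI)
  qed
  have g: "?g y \<in> ?S" if y: "y \<in> ?T" for y
  proof -
    obtain i where i: "i < m" "0 \<le> y i"
      using y by blast
    then have "?g y (3 * i + 2) = 0"
      unfolding pair_parts_simps(2)[OF i(1)] by simp
    with i(1) show ?thesis
      by (intro CollectI exI conjI)
  qed
  have "homeomorphic_maps (subtopology (top_of_set ?X) ?S)
      (subtopology (top_of_set (unit_sphere m)) ?T) ?f ?g"
  proof (rule homeomorphic_maps_subtopologies_alt[OF homeomorphic_maps_cross_polytope])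
    show "?f ` (topspace (top_of_set ?X) \<inter> ?S) \<subseteq> ?T"
      by (intro image_subsetI f) (simp only: topspace_euclidean_subtopology)
    show "?g ` (topspace (top_of_set (unit_sphere m)) \<inter> ?T) \<subseteq> ?S"
      by (intro image_subsetI g) (simp only: Int_iff)
  qed
  then have "top_of_set (?X \<inter> ?S) homeomorphic_space top_of_set (unit_sphere m \<inter> ?T)"
    unfolding subtopology_subtopology by (rule homeomorphic_maps_imp_homeomorphic_space)
  moreover have "unit_sphere m \<inter> ?T = {y \<in> unit_sphere m. \<exists>i<m. 0 \<le> y i}"
    by (simp only: Int_def mem_Collect_eq)
  ultimately have contr: "contractible_space (top_of_set (?X \<inter> ?S))"
    using contractible_space_sphere_part[OF assms]
    by (simp only: homeomorphic_space_contractibility)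
  \<comment> \<open>The vertex 1, opposite to the vertex 2 of the facet, shows that the remaining
    realization is nonempty.\<close>
  let ?c = "\<lambda>v::nat. if v = 1 then 1 else 0 :: real"
  have "1 \<in> pair_vertices m"
    using assms by (simp add: pair_vertices_def)
  then have "{1} \<in> indep (pair_vertices m)"
    by (simp add: indep_def)
  then have "?c \<in> ?X"
    by (rule realization_pointsI) auto
  moreover have "?c (3 * 0 + 2) = 0"
    by simp
  then have "?c \<in> ?S"
    using assms by (intro CollectI exI conjI)
  ultimately have "?X \<inter> ?S \<noteq> {}"
    by blast
  with contr show ?thesis
    unfolding contractible_complex_def geometric_realization_eq eq topspace_euclidean_subtopology
    by (rule conjI)
qed

section \<open>The suspension as a join with two poles\<close>

lemma compact_realization_points_indep:
  assumes "finite V"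
  shows "compact (realization_points (indep V))"
proof -
  let ?P = "\<Pi>\<^sub>E v\<in>UNIV. {0..1::real}"
  have coord: "continuous_on UNIV (\<lambda>x :: nat \<Rightarrow> real. x v)" for v
    by (rule continuous_on_product_then_coordinatewise[OF continuous_on_id])
  have "compactin (product_topology (\<lambda>_. euclidean) UNIV) ?P"
    by (subst compactin_PiE) auto
  then have "compact ?P"
    by (simp add: euclidean_product_topology)
  moreover have "closed (realization_points (indep V))"
  proof -
    \<comment> \<open>The disjunction on neighbouring coordinates is rewritten as a vanishing
      product, so that every condition is a closed one.\<close>
    have "realization_points (indep V) =
        (\<Inter>v. {x. 0 \<le> x v}) \<inter> (\<Inter>v\<in>-V. {x. x v = 0}) \<inter> {x. sum x V = 1} \<inter>
        (\<Inter>i. {x. x i * x (Suc i) = 0})"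
      using realization_points_indep[OF assms] by auto
    moreover have "closed {x :: nat \<Rightarrow> real. 0 \<le> x v}" "closed {x :: nat \<Rightarrow> real. x v = 0}"
        "closed {x :: nat \<Rightarrow> real. x v * x (Suc v) = 0}" for v
      by (rule closed_Collect_le closed_Collect_eq; intro continuous_on_const continuous_on_mult coord)+
    moreover have "closed {x :: nat \<Rightarrow> real. sum x V = 1}"
      by (rule closed_Collect_eq; intro continuous_on_const continuous_on_sum coord)
    ultimately show ?thesis
      by (simp only:) (intro closed_Int closed_INT ballI; assumption)
  qed
  moreover have "realization_points (indep V) \<subseteq> ?P"
  proof
    fix x
    assume x: "x \<in> realization_points (indep V)"
    have "x v \<le> 1" for v
    proof (cases "v \<in> V")
      case True
      then have "x v \<le> sum x V"
        using x assms by (intro member_le_sum) (auto simp: realization_points_indep)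
      then show ?thesis
        using x assms by (simp add: realization_points_indep)
    qed (use x assms in \<open>simp add: realization_points_indep\<close>)
    then show "x \<in> ?P"
      using x assms by (auto simp: realization_points_indep)
  qed
  ultimately show ?thesis
    by (metis closed_Int_compact inf.absorb1)
qed

text \<open>As \<open>t\<close> runs from 0 to 1/2 the weight moves from the pole \<open>a\<close>
  to \<open>x\<close>, and from 1/2 to 1 it moves on to the pole \<open>b\<close>. The poles never
  carry weight at the same time, and together they carry \<bar>2 * t - 1\<bar>.\<close>

definition join_poles :: "nat \<Rightarrow> nat \<Rightarrow> (nat \<Rightarrow> real) \<times> real \<Rightarrow> nat \<Rightarrow> real" where
  "join_poles a b = (\<lambda>(x, t) v.
     if v = a then max 0 (1 - 2 * t) else if v = b then max 0 (2 * t - 1)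
     else (1 - \<bar>2 * t - 1\<bar>) * x v)"

text \<open>The weights at the poles determine \<open>t\<close>. For \<open>0 < t < 1\<close> the
  factor of \<open>x\<close> is nonzero, which recovers \<open>x\<close> away from the poles, and at
  the poles \<open>x\<close> is 0. At both ends the factor is 0, which matches the collapse in the
  suspension.\<close>

lemma join_poles_eq_iff:
  assumes a: "\<And>x. x \<in> X \<Longrightarrow> x a = 0" and b: "\<And>x. x \<in> X \<Longrightarrow> x b = 0" and "a \<noteq> b"
    and z: "z \<in> X \<times> {0..1}" "z' \<in> X \<times> {0..1}"
  shows "join_poles a b z = join_poles a b z' \<longleftrightarrow>
    suspension_class (top_of_set X) z = suspension_class (top_of_set X) z'"
proof -
  obtain x t x' t' where [simp]: "z = (x, t)" "z' = (x', t')"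
    by (cases z, cases z') auto
  have x: "x \<in> X" "x' \<in> X" "0 \<le> t" "t \<le> 1" "0 \<le> t'" "t' \<le> 1"
    using z by auto
  \<comment> \<open>A class remembers the height \<open>s\<close>; for the collapsed ends this rests
    on \<open>X\<close> being nonempty.\<close>
  have snd: "snd ` suspension_class (top_of_set X) (y, s) = {s}" for y s
    using x(1) by (auto simp: suspension_class_def image_iff)
  have *: "suspension_class (top_of_set X) z = suspension_class (top_of_set X) z' \<longleftrightarrow>
      t = t' \<and> (t = 0 \<or> t = 1 \<or> x = x')"
  proof
    assume eq: "suspension_class (top_of_set X) z = suspension_class (top_of_set X) z'"
    then have "t = t'"
      using snd[of x t] snd[of x' t'] by simp
    with eq show "t = t' \<and> (t = 0 \<or> t = 1 \<or> x = x')"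
      by (simp add: suspension_class_def split: if_splits)
  qed (auto simp: suspension_class_def)
  have "t = t' \<and> (t = 0 \<or> t = 1 \<or> x = x')" if eq: "join_poles a b z = join_poles a b z'"
  proof -
    have "max 0 (1 - 2 * t) = max 0 (1 - 2 * t')"
      using fun_cong[OF eq, of a] by (simp add: join_poles_def)
    moreover have "max 0 (2 * t - 1) = max 0 (2 * t' - 1)"
      using fun_cong[OF eq, of b] \<open>a \<noteq> b\<close> by (simp add: join_poles_def)
    ultimately have t: "t = t'"
      by linarith
    moreover have "x = x'" if "t \<noteq> 0" "t \<noteq> 1"
    proof
      fix v
      have "1 - \<bar>2 * t - 1\<bar> \<noteq> 0"
        using x that by linarith
      moreover have "(1 - \<bar>2 * t - 1\<bar>) * x v = (1 - \<bar>2 * t - 1\<bar>) * x' v" if "v \<noteq> a" "v \<noteq> b"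
        using fun_cong[OF eq, of v] t that by (simp add: join_poles_def)
      ultimately show "x v = x' v"
        using a[OF x(1)] a[OF x(2)] b[OF x(1)] b[OF x(2)] mult_left_cancel by metis
    qed
    ultimately show ?thesis
      by blast
  qed
  moreover have "join_poles a b z = join_poles a b z'" if "t = t' \<and> (t = 0 \<or> t = 1 \<or> x = x')"
  proof
    fix v
    show "join_poles a b z v = join_poles a b z' v"
      using that by (elim conjE disjE) (simp_all add: join_poles_def)
  qed
  ultimately show ?thesis
    using * by blast
qed

lemma continuous_on_join_poles: "continuous_on S (join_poles a b)"
proof (rule continuous_on_coordinatewise_then_product)
  fix v
  have "continuous_on S (\<lambda>z. fst z v)"
    by (rule continuous_on_product_then_coordinatewise[OF continuous_on_fst[OF continuous_on_id]])
  then show "continuous_on S (\<lambda>z. join_poles a b z v)"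
    unfolding join_poles_def case_prod_beta
    by (cases "v = a"; cases "v = b") (simp_all, (intro continuous_on_max continuous_on_mult
        continuous_on_diff continuous_on_rabs continuous_on_const continuous_on_snd continuous_on_id)+)
qed

text \<open>The poles \<open>n + 2\<close> and \<open>n + 3\<close> exclude each other, and since
  \<open>n + 1\<close> is missing, neither has a neighbour in \<open>{1..n}\<close>. Conversely,
  \<open>t\<close> is read off from the weights at the poles, and \<open>x\<close> is the rest of
  \<open>y\<close> rescaled to total weight 1.\<close>

lemma join_poles_image:
  assumes "1 \<le> n"
  shows "join_poles (n + 2) (n + 3) ` (realization_points (indep {1..n}) \<times> {0..1}) =
    realization_points (indep ({1..n} \<union> {n + 2, n + 3}))"
    (is "?q ` (?X \<times> _) = ?Y")
proof -
  have V: "finite {1..n}" "finite ({1..n} \<union> {n + 2, n + 3})"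
    by auto
  have sumV: "sum f ({1..n} \<union> {n + 2, n + 3}) = sum f {1..n} + (f (n + 2) + f (n + 3))"
    for f :: "nat \<Rightarrow> real"
    by (subst sum.union_disjoint) auto
  show ?thesis
  proof (intro equalityI subsetI)
    fix y
    assume "y \<in> ?q ` (?X \<times> {0..1})"
    then obtain x t where x: "x \<in> ?X" and t: "0 \<le> t" "t \<le> 1" and y: "y = ?q (x, t)"
      by auto
    have x': "\<And>v. 0 \<le> x v" "\<And>v. v \<notin> {1..n} \<Longrightarrow> x v = 0" "sum x {1..n} = 1"
        "\<And>i. x i = 0 \<or> x (Suc i) = 0"
      using x unfolding realization_points_indep[OF V(1)] by blast+
    have ya: "y (n + 2) = max 0 (1 - 2 * t)" and yb: "y (n + 3) = max 0 (2 * t - 1)"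
      and yv: "\<And>v. v \<noteq> n + 2 \<Longrightarrow> v \<noteq> n + 3 \<Longrightarrow> y v = (1 - \<bar>2 * t - 1\<bar>) * x v"
      unfolding y join_poles_def by auto
    have "sum y {1..n} = (\<Sum>v\<in>{1..n}. (1 - \<bar>2 * t - 1\<bar>) * x v)"
      by (intro sum.cong) (auto simp: yv)
    also have "\<dots> = 1 - \<bar>2 * t - 1\<bar>"
      using x'(3) by (simp flip: sum_distrib_left)
    finally have "sum y ({1..n} \<union> {n + 2, n + 3}) = 1"
      unfolding sumV ya yb by (simp add: max_def abs_if)
    moreover have "0 \<le> y v" for v
    proof (cases "v = n + 2 \<or> v = n + 3")
      case False
      have "0 \<le> 1 - \<bar>2 * t - 1\<bar>"
        using t by auto
      with False show ?thesis
        using x'(1) by (simp add: yv)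
    qed (use ya yb in auto)
    moreover have y0: "y v = 0" if "v \<notin> {1..n} \<union> {n + 2, n + 3}" for v
      using that x'(2) by (subst yv) auto
    moreover have "y i = 0 \<or> y (Suc i) = 0" for i
    proof (cases "i \<ge> n")
      case True
      then consider "i = n" | "i = n + 1" | "i = n + 2" | "i \<ge> n + 3"
        by linarith
      then show ?thesis
      proof cases
        case 3
        then show ?thesis
          using ya yb by (auto simp: max_def numeral_3_eq_3)
      qed (use y0[of "n + 1"] y0[of "Suc i"] in auto)
    next
      case False
      then show ?thesis
        using x'(4)[of i] yv[of i] yv[of "Suc i"] by auto
    qed
    ultimately show "y \<in> ?Y"
      unfolding realization_points_indep[OF V(2)] by blast
  next
    fix y
    assume "y \<in> ?Y"
    then have y: "\<And>v. 0 \<le> y v" "\<And>v. v \<notin> {1..n} \<union> {n + 2, n + 3} \<Longrightarrow> y v = 0"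
        "sum y {1..n} + (y (n + 2) + y (n + 3)) = 1" "\<And>i. y i = 0 \<or> y (Suc i) = 0"
      unfolding realization_points_indep[OF V(2)] sumV by blast+
    define s where "s = sum y {1..n}"
    define t where "t = (1 - y (n + 2) + y (n + 3)) / 2"
    \<comment> \<open>If all the weight is at a pole, any point of \<open>?X\<close> will do; the
      vertex 1 is chosen, which exists because \<open>1 \<le> n\<close>.\<close>
    define x where "x = (\<lambda>v. if s = 0 then if v = 1 then 1 else 0
      else if v \<in> {1..n} then y v / s else 0)"
    have ab: "y (n + 2) = 0 \<or> y (n + 3) = 0"
      using y(4)[of "n + 2"] by (simp add: numeral_3_eq_3)
    have s0: "0 \<le> s"
      unfolding s_def using y(1) by (intro sum_nonneg)
    have s1: "s + (y (n + 2) + y (n + 3)) = 1"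
      using y(3) by (simp add: s_def)
    have "2 * t = 1 - y (n + 2) + y (n + 3)"
      by (simp add: t_def)
    \<comment> \<open>One of the weights at the poles is 0, so \<bar>2 * t - 1\<bar> is their sum,
      and \<open>s\<close> is what remains.\<close>
    then have t: "0 \<le> t" "t \<le> 1" "max 0 (1 - 2 * t) = y (n + 2)" "max 0 (2 * t - 1) = y (n + 3)"
        "1 - \<bar>2 * t - 1\<bar> = s"
      using ab s0 s1 y(1)[of "n + 2"] y(1)[of "n + 3"] by (auto simp: max_def)
    have "sum x {1..n} = 1"
    proof (cases "s = 0")
      case True
      then show ?thesis
        using assms by (simp add: x_def)
    next
      case False
      then have "sum x {1..n} = (\<Sum>v\<in>{1..n}. y v / s)"
        by (intro sum.cong) (auto simp: x_def)
      also have "\<dots> = 1"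
        using False by (simp add: s_def flip: sum_divide_distrib)
      finally show ?thesis .
    qed
    moreover have "0 \<le> x v" "v \<notin> {1..n} \<Longrightarrow> x v = 0" "x v = 0 \<or> x (Suc v) = 0" for v
      using y(1)[of v] y(4)[of v] s0 assms by (auto simp: x_def)
    ultimately have "x \<in> ?X"
      unfolding realization_points_indep[OF V(1)] by blast
    moreover have "?q (x, t) = y"
    proof
      fix v
      have "s * x v = y v" if "v \<noteq> n + 2" "v \<noteq> n + 3"
      proof (cases "v \<in> {1..n}")
        case True
        have "y v \<le> s"
          unfolding s_def using True y(1) by (intro member_le_sum) auto
        then show ?thesis
          using True y(1)[of v] by (auto simp: x_def)
      next
        case False
        then show ?thesis
          using that y(2)[of v] assms by (auto simp: x_def)
      qed
      then show "?q (x, t) v = y v"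
        using t(3-5) by (simp add: join_poles_def)
    qed
    ultimately show "y \<in> ?q ` (?X \<times> {0..1})"
      using t(1,2) by (metis SigmaI atLeastAtMost_iff image_eqI)
  qed
qed

text \<open>Two quotient maps with the same fibres factor through each other, and the two factors
  are mutually inverse.\<close>

lemma homeomorphic_space_quotients:
  assumes f: "quotient_map X Y f" and g: "quotient_map X Z g"
    and eq: "\<And>x x'. x \<in> topspace X \<Longrightarrow> x' \<in> topspace X \<Longrightarrow> f x = f x' \<longleftrightarrow> g x = g x'"
  shows "Y homeomorphic_space Z"
proof -
  obtain h where h: "continuous_map Y Z h" "\<And>x. x \<in> topspace X \<Longrightarrow> h (f x) = g x"
    using quotient_map_lift_exists[OF f quotient_imp_continuous_map[OF g]] eq by metis
  obtain k where k: "continuous_map Z Y k" "\<And>x. x \<in> topspace X \<Longrightarrow> k (g x) = f x"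
    using quotient_map_lift_exists[OF g quotient_imp_continuous_map[OF f]] eq by metis
  have "topspace Y = f ` topspace X" "topspace Z = g ` topspace X"
    using f g by (simp_all add: quotient_imp_surjective_map)
  then have "homeomorphic_maps Y Z h k"
    using h k by (auto simp: homeomorphic_maps_def)
  then show ?thesis
    unfolding homeomorphic_space_def by blast
qed

text \<open>\<open>join_poles\<close> and \<open>suspension_class\<close> are quotient maps on the
  same cylinder with the same fibres. The former is one because it maps a compact space continuously
  onto a Hausdorff space.\<close>

lemma suspension_homeomorphic:
  assumes "1 \<le> n"
  shows "geometric_realization (indep ({1..n} \<union> {n + 2, n + 3})) homeomorphic_space
    suspension (geometric_realization (indep {1..n}))"
proof -
  let ?X = "realization_points (indep {1..n})"
  let ?Y = "realization_points (indep ({1..n} \<union> {n + 2, n + 3}))"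
  let ?q = "join_poles (n + 2) (n + 3)"
  let ?C = "prod_topology (top_of_set ?X) (top_of_set {0..1::real})"
  have "quotient_map ?C (top_of_set ?Y) ?q"
  proof (rule continuous_imp_quotient_map)
    show "continuous_map ?C (top_of_set ?Y) ?q"
      using join_poles_image[OF assms] by (simp add: continuous_on_join_poles image_subset_iff_funcset[symmetric])
    show "compact_space ?C"
      by (intro iffD2[OF compact_space_prod_topology] disjI2 conjI compact_space_subtopology)
        (simp_all add: compact_realization_points_indep)
    show "Hausdorff_space (top_of_set ?Y)"
      by (simp add: Hausdorff_space_subtopology)
    show "?q ` topspace ?C = topspace (top_of_set ?Y)"
      using join_poles_image[OF assms] by simp
  qed
  moreover have "?q z = ?q z' \<longleftrightarrow> suspension_class (top_of_set ?X) z = suspension_class (top_of_set ?X) z'"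
    if "z \<in> topspace ?C" "z' \<in> topspace ?C" for z z'
    using that by (intro join_poles_eq_iff) (auto simp: realization_points_indep)
  ultimately show ?thesis
    unfolding geometric_realization_eq
    using quotient_map_suspension_class by (intro homeomorphic_space_quotients) blast+
qed

text \<open>The fold of \<open>n + 1\<close> onto \<open>n + 3\<close> is admissible because a face
  with \<open>n + 1\<close> does not contain \<open>n + 2\<close>, and \<open>n + 4\<close> is not a
  vertex.\<close>

lemma suspension_homotopy_equivalent:
  assumes "1 \<le> n"
  shows "geometric_realization (L_complex (n + 3)) homotopy_equivalent_space
    suspension (geometric_realization (L_complex n))"
proof -
  have "geometric_realization (indep {1..n + 3}) homotopy_equivalent_space
      geometric_realization {\<sigma> \<in> indep {1..n + 3}. n + 1 \<notin> \<sigma>}"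
  proof (rule homotopy_equivalent_fold)
    show "n + 3 \<noteq> n + 1"
      by simp
    fix \<sigma>
    assume \<sigma>: "\<sigma> \<in> indep {1..n + 3}" and v: "n + 1 \<in> \<sigma>"
    have \<sigma>': "\<sigma> \<subseteq> {1..n + 3}" "\<And>i. i \<in> \<sigma> \<Longrightarrow> Suc i \<notin> \<sigma>"
      using \<sigma> by (auto simp: indep_def)
    have "n + 2 \<notin> \<sigma>"
      using \<sigma>'(2)[OF v] by simp
    moreover have "n + 4 \<notin> \<sigma>"
      using \<sigma>'(1) by auto
    moreover have "\<not> (i \<in> insert (n + 3) \<sigma> \<and> Suc i \<in> insert (n + 3) \<sigma>)" for i
    proof
      assume i: "i \<in> insert (n + 3) \<sigma> \<and> Suc i \<in> insert (n + 3) \<sigma>"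
      then consider "i = n + 3" | "Suc i = n + 3" | "i \<in> \<sigma>" "Suc i \<in> \<sigma>"
        by blast
      then show False
      proof cases
        case 1
        then have "Suc i = n + 4"
          by simp
        with i \<open>n + 4 \<notin> \<sigma>\<close> show False
          by simp
      next
        case 2
        then have "i = n + 2"
          by simp
        with i \<open>n + 2 \<notin> \<sigma>\<close> show False
          by simp
      qed (use \<sigma>'(2) in blast)
    qed
    ultimately have "insert (n + 3) \<sigma> \<in> indep {1..n + 3}"
      using \<sigma>'(1) unfolding indep_def by (intro CollectI conjI allI) auto
    then show "insert (n + 3) \<sigma> \<in> indep {1..n + 3} \<and> insert (n + 3) \<sigma> - {n + 1} \<in> indep {1..n + 3}"
      by (auto simp: indep_def)
  qed
  also have "{\<sigma> \<in> indep {1..n + 3}. n + 1 \<notin> \<sigma>} = indep ({1..n + 3} - {n + 1})"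
    by (auto simp: indep_def)
  also have "{1..n + 3} - {n + 1} = {1..n} \<union> {n + 2, n + 3}"
    by auto
  also have "geometric_realization (indep ({1..n} \<union> {n + 2, n + 3})) homotopy_equivalent_space
      suspension (geometric_realization (indep {1..n}))"
    by (rule homeomorphic_imp_homotopy_equivalent_space[OF suspension_homeomorphic[OF assms]])
  finally show ?thesis
    unfolding L_complex_eq_indep .
qed

section \<open>Homotopy types and generating facets of \<open>L_complex\<close>\<close>

lemma contractible_complex_homotopy_equivalent:
  assumes "geometric_realization K homotopy_equivalent_space geometric_realization L"
    and "contractible_complex L"
  shows "contractible_complex K"
proof -
  \<comment> \<open>A map out of the nonempty realization of \<open>L\<close> shows that the
    realization of \<open>K\<close> is nonempty too.\<close>
  obtain g where "continuous_map (geometric_realization L) (geometric_realization K) g"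
    using assms(1) unfolding homotopy_equivalent_space_def by blast
  then have "topspace (geometric_realization K) \<noteq> {}"
    using assms(2) unfolding contractible_complex_def continuous_map_def by blast
  with assms(2) show ?thesis
    unfolding contractible_complex_def homotopy_equivalent_space_contractibility[OF assms(1)] by blast
qed

lemma contractible_complex_homotopy_equivalent_point:
  assumes "contractible_complex K"
  shows "geometric_realization K homotopy_equivalent_space discrete_topology {()}"
proof -
  let ?X = "geometric_realization K"
  obtain a where a: "a \<in> topspace ?X"
    using assms unfolding contractible_complex_def by blast
  then have "homotopic_with (\<lambda>_. True) ?X ?X id (\<lambda>_. a)"
    using assms unfolding contractible_complex_def contractible_space_alt by blast
  then have "homotopic_with (\<lambda>_. True) ?X ?X ((\<lambda>_. a) \<circ> (\<lambda>_. ())) id"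
    by (simp add: o_def homotopic_with_sym)
  moreover have "homotopic_with (\<lambda>_. True) (discrete_topology {()}) (discrete_topology {()})
      ((\<lambda>_. ()) \<circ> (\<lambda>_. a)) id"
    by (rule homotopic_with_equal) auto
  ultimately show ?thesis
    unfolding homotopy_equivalent_space_def
    using a by (intro exI[of _ "\<lambda>_. ()"] exI[of _ "\<lambda>_. a"]) simp
qed

text \<open>Once the multiples of 3 are folded away, the last vertex \<open>3 * k + 1\<close> has no
  neighbour left and is the apex of a cone.\<close>

lemma contractible_complex_L_complex: "contractible_complex (L_complex (3 * k + 1))"
proof -
  let ?n = "3 * k + 1"
  let ?K = "indep {i\<in>{1..?n}. \<not> 3 dvd i}"
  have "geometric_realization (L_complex ?n) homotopy_equivalent_space geometric_realization ?K"
    using homotopy_equivalent_non_multiples[of "{}" ?n] by (simp add: L_complex_eq_indep)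
  moreover have "contractible_complex ?K"
  proof (rule contractible_complex_cone)
    show "{} \<in> ?K"
      by (simp add: indep_def)
    fix \<sigma>
    assume \<sigma>: "\<sigma> \<in> ?K"
    then have "3 * k \<notin> \<sigma>" "Suc ?n \<notin> \<sigma>"
      by (auto simp: indep_def)
    moreover have "\<not> 3 dvd ?n"
      by presburger
    ultimately show "insert ?n \<sigma> \<in> ?K"
      using \<sigma> by (auto simp: indep_def)
  qed
  ultimately show ?thesis
    by (rule contractible_complex_homotopy_equivalent)
qed

text \<open>The lengths \<open>3 * m\<close> and \<open>3 * m - 1\<close> differ only by a multiple
  of 3 as last vertex, so the folds leave the same \<open>m\<close> pairs.\<close>

lemma L_complex_pairs:
  assumes "n = 3 * m \<or> Suc n = 3 * m"
    and "\<And>F i. F \<in> S \<Longrightarrow> i \<in> F \<Longrightarrow> i mod 3 = 2"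
  shows "geometric_realization (L_complex n - S) homotopy_equivalent_space
    geometric_realization (indep (pair_vertices m) - S)"
proof -
  have "{i\<in>{1..n}. \<not> 3 dvd i} = pair_vertices m"
  proof (rule set_eqI)
    fix i
    have "1 \<le> i \<and> (i \<le> n \<longleftrightarrow> i div 3 < m)" if "\<not> 3 dvd i"
    proof -
      have "i = 3 * (i div 3) + i mod 3" "i mod 3 < 3" "0 < i mod 3"
        using that by (simp_all add: dvd_eq_mod_eq_0)
      with assms(1) show ?thesis
        by linarith
    qed
    then show "i \<in> {i\<in>{1..n}. \<not> 3 dvd i} \<longleftrightarrow> i \<in> pair_vertices m"
      by (auto simp: pair_vertices_def dvd_eq_mod_eq_0)
  qed
  moreover have "geometric_realization (indep {1..n} - S) homotopy_equivalent_space
      geometric_realization (indep {i\<in>{1..n}. \<not> 3 dvd i} - S)"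
    by (rule homotopy_equivalent_non_multiples) (rule assms(2))
  ultimately show ?thesis
    by (simp only: L_complex_eq_indep)
qed

lemma L_complex_homotopy_equivalent_sphere:
  assumes "n = 3 * m + 2 \<or> n = 3 * m + 3"
  shows "geometric_realization (L_complex n) homotopy_equivalent_space nsphere m"
proof -
  have "geometric_realization (L_complex n) homotopy_equivalent_space
      geometric_realization (indep (pair_vertices (Suc m)))"
    using L_complex_pairs[of n "Suc m" "{}"] assms by auto
  also have "\<dots> homotopy_equivalent_space nsphere m"
    unfolding nsphere_eq
    by (rule homeomorphic_imp_homotopy_equivalent_space[OF unit_sphere_homeomorphic_pairs])
  finally show ?thesis .
qed

text \<open>The facet is maximal because each vertex outside it is next to one of its elements. Its
  elements are all congruent to 2 modulo 3, so the folds remain valid after its deletion and reduce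
  the claim to the cross-polytope.\<close>

lemma generating_L_complex:
  assumes n: "n = 3 * m \<or> Suc n = 3 * m" and m: "0 < m"
  shows "generating (L_complex n) {{3 * j + 2 |j. j < m}}"
proof -
  define F where "F = {3 * j + 2 |j. j < m}"
  have F: "i \<in> F \<longleftrightarrow> (\<exists>j<m. i = 3 * j + 2)" for i
    unfolding F_def by blast
  have F_mod: "i mod 3 = 2" if "i \<in> F" for i
    using that unfolding F by presburger
  have L: "G \<in> L_complex n \<longleftrightarrow> (\<forall>i\<in>G. 1 \<le> i \<and> i \<le> n \<and> Suc i \<notin> G)" for G
    unfolding L_complex_eq_indep indep_def by auto
  have "F \<in> L_complex n"
    unfolding L
  proof (intro ballI conjI)
    fix i
    assume i: "i \<in> F"
    then obtain j where j: "j < m" "i = 3 * j + 2"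
      unfolding F by blast
    then show "1 \<le> i" "i \<le> n"
      using n by linarith+
    show "Suc i \<notin> F"
    proof
      assume "Suc i \<in> F"
      from F_mod[OF this] F_mod[OF i] show False
        by presburger
    qed
  qed
  moreover have "G = F" if G: "G \<in> L_complex n" and FG: "F \<subseteq> G" for G
  proof (rule ccontr)
    assume "G \<noteq> F"
    with FG obtain v where v: "v \<in> G" "v \<notin> F"
      by blast
    have G': "1 \<le> i" "i \<le> n" "Suc i \<notin> G" if "i \<in> G" for i
      using that G unfolding L by blast+
    \<comment> \<open>\<open>j\<close> numbers the block of three consecutive vertices around
      \<open>v\<close>; the middle vertex of the block belongs to \<open>F\<close>.\<close>
    obtain j where "v = 3 * j + 1 \<or> v = 3 * j + 2 \<or> v = 3 * j + 3"
    proof (rule that)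
      show "v = 3 * ((v - 1) div 3) + 1 \<or> v = 3 * ((v - 1) div 3) + 2 \<or> v = 3 * ((v - 1) div 3) + 3"
        using G'(1)[OF v(1)] by presburger
    qed
    moreover from this have "j < m"
      using n G'(2)[OF v(1)] by linarith
    then have "3 * j + 2 \<in> F"
      unfolding F by blast
    ultimately consider "Suc v \<in> G" | "v \<in> F" | "3 * j + 2 \<in> G" "v = Suc (3 * j + 2)"
      using FG by (auto simp: numeral_3_eq_3)
    then show False
      by cases (use v G'(3) in blast)+
  qed
  ultimately have "{F} \<subseteq> maximal_simplices (L_complex n)"
    unfolding maximal_simplices_def by blast
  moreover have "contractible_complex (L_complex n - {F})"
  proof (rule contractible_complex_homotopy_equivalent)
    show "geometric_realization (L_complex n - {F}) homotopy_equivalent_space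
        geometric_realization (indep (pair_vertices m) - {F})"
      by (rule L_complex_pairs[OF n]) (simp add: F_mod)
  qed (use contractible_complex_pairs_minus_facet[OF m] in \<open>simp only: F_def\<close>)
  ultimately show ?thesis
    unfolding generating_def F_def by simp
qed

text \<open>There is no multiple of 3 to fold away, so the comparison with the sphere is a
  homeomorphism.\<close>

lemma L_complex_2: "geometric_realization (L_complex 2) homeomorphic_space nsphere 0"
proof -
  have "{1..2} = pair_vertices 1"
    by (auto simp: pair_vertices_Suc[of 0, simplified] pair_vertices_def[of 0])
  then show ?thesis
    unfolding L_complex_eq_indep nsphere_eq using unit_sphere_homeomorphic_pairs[of 1] by simp
qed

theorem proposition4p4p6:
  shows
    "(\<forall>n\<ge>1. geometric_realization (L_complex (n + 3)) homotopy_equivalent_space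
             suspension (geometric_realization (L_complex n)))
     \<and> (\<forall>n k. n \<ge> 1 \<longrightarrow>
          (n = 3 * k + 2 \<longrightarrow> generating (L_complex n) {{3 * j + 2 |j. j \<le> k}}) \<and>
          (n = 3 * k \<longrightarrow> generating (L_complex n) {{3 * j + 2 |j. j < k}}))
     \<and> contractible_complex (L_complex 1)
     \<and> geometric_realization (L_complex 2) homeomorphic_space nsphere 0
     \<and> geometric_realization (L_complex 3) homotopy_equivalent_space nsphere 0
     \<and> (\<forall>n k. n \<ge> 1 \<longrightarrow>
          (n = 3 * k \<longrightarrow>
             geometric_realization (L_complex n) homotopy_equivalent_space nsphere (k - 1)) \<and>
          (n = 3 * k + 1 \<longrightarrow>
             geometric_realization (L_complex n) homotopy_equivalent_space discrete_topology {()}) \<and>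
          (n = 3 * k + 2 \<longrightarrow>
             geometric_realization (L_complex n) homotopy_equivalent_space nsphere k))"
proof (intro conjI allI impI)
  fix n k :: nat
  assume n: "n \<ge> 1"
  show "geometric_realization (L_complex (n + 3)) homotopy_equivalent_space
      suspension (geometric_realization (L_complex n))"
    by (rule suspension_homotopy_equivalent[OF n])
  \<comment> \<open>The condition \<open>j \<le> k\<close> describes \<open>k + 1\<close> pairs, so
    \<open>m\<close> is \<open>Suc k\<close>.\<close>
  show "generating (L_complex n) {{3 * j + 2 |j. j \<le> k}}" if "n = 3 * k + 2"
    using generating_L_complex[of n "Suc k"] that by (simp add: less_Suc_eq_le)
  show "generating (L_complex n) {{3 * j + 2 |j. j < k}}" if "n = 3 * k"
    using generating_L_complex[of n k] that n by simp
  \<comment> \<open>From \<open>n \<ge> 1\<close> follows \<open>k \<ge> 1\<close>, so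
    \<open>k - 1\<close> is a true difference and \<open>n = 3 * (k - 1) + 3\<close>.\<close>
  show "geometric_realization (L_complex n) homotopy_equivalent_space nsphere (k - 1)"
    if "n = 3 * k"
    using that n by (intro L_complex_homotopy_equivalent_sphere) arith
  show "geometric_realization (L_complex n) homotopy_equivalent_space discrete_topology {()}"
    if "n = 3 * k + 1"
    unfolding that
    by (rule contractible_complex_homotopy_equivalent_point[OF contractible_complex_L_complex])
  show "geometric_realization (L_complex n) homotopy_equivalent_space nsphere k"
    if "n = 3 * k + 2"
    using that by (intro L_complex_homotopy_equivalent_sphere) simp
next
  show "contractible_complex (L_complex 1)"
    using contractible_complex_L_complex[of 0] by simp
  show "geometric_realization (L_complex 2) homeomorphic_space nsphere 0"
    by (rule L_complex_2)
  show "geometric_realization (L_complex 3) homotopy_equivalent_space nsphere 0"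
    by (rule L_complex_homotopy_equivalent_sphere) simp
qed

end
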